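(* Assume that $\|\nabla F(x)-\nabla F(x')\|_\infty\le M_F\|x-x'\|_1$ for all $x,x'\in\mathbb{R}^n$ and $\sup_{\|x\|_1\le B^2/2}\|\nabla F(x)\|_\infty\le K$. Let $M_G>0$ be an upper bound on the Lipschitz constant of $\nabla G$ on the ball $\{(u,v):\frac12(\|u\|^2+\|v\|^2)\le\frac12B^2\}$, let $\kappa=\max(1,(1+K^2)/M_G)$ and let the stepsize be $\tau=1/(\kappa M_G)$. Let $\rho=1-\frac{1}{\kappa M_G}$. Then there is a constant $C$, independent of $k$, such that the gradient descent iterates satisfy, with $x_k=u_k\odot v_k$, for all $k$, $$\Phi(x_k)-\lim_{j\to\infty}\Phi(x_j)\le C\sum_{j=k}^\infty\|\nabla G(u_j,v_j)\|^2+C\rho^k.$$ In particular, if $\|\nabla G(u_k,v_k)\|=O(1/k)$, then the objective converges at rate $O(1/k)$, i.e. $\Phi(x_k)-\lim_{j\to\infty}\Phi(x_j)=O(1/k)$.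
   Context: All groups are trivial (size one). $F:\mathbb{R}^n\to\mathbb{R}$ is differentiable and convex, $\Phi(x)=F(x)+\|x\|_1$, $u\odot v=(u_iv_i)_i$ is the entrywise product, and $$G(u,v)=\tfrac12\|u\|_2^2+\tfrac12\|v\|_2^2+F(u\odot v),\qquad u,v\in\mathbb{R}^n.$$ Unsubscripted norms are Euclidean. Gradient descent with stepsize $\tau$ from $(u_0,v_0)$ is $$u_{k+1}=u_k-\tau(u_k+v_k\odot\nabla F(u_k\odot v_k)),\qquad v_{k+1}=v_k-\tau(v_k+u_k\odot\nabla F(u_k\odot v_k)).$$ The constant $B$ is defined by $\frac12B^2=G(u_0,v_0)$, and it is assumed throughout that all iterates satisfy $\frac12(\|u_k\|^2+\|v_k\|^2)\le\frac12B^2$. *)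

theory Defs
  imports "HOL-Analysis.Analysis" "HOL-Library.Landau_Symbols"
begin

(* Unspecified where f is not differentiable; see gradient_works.  On a product type the inner
   product, and hence the gradient, is the Euclidean one of the product space. *)
definition gradient :: "('a::real_inner \<Rightarrow> real) \<Rightarrow> 'a \<Rightarrow> 'a" where
  "gradient f x = (THE D. GDERIV f x :> D)"

lemma gradient_eqI:
  assumes "GDERIV f x :> D"
  shows "gradient f x = D"
  unfolding gradient_def
proof (rule the_equality)
  show "GDERIV f x :> D" by (fact assms)
next
  fix E assume "GDERIV f x :> E"
  then have "(\<lambda>h. inner h E) = (\<lambda>h. inner h D)"
    using assms has_derivative_unique unfolding gderiv_def by blast
  then have "\<forall>h. inner h E = inner h D"
    by meson
  then show "E = D"
    by (metis inner_commute vector_eq_rdot)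
qed

lemma gradient_works:
  fixes f :: "'a::euclidean_space \<Rightarrow> real"
  assumes "f differentiable (at x)"
  shows "GDERIV f x :> gradient f x"
proof -
  obtain f' where f': "(f has_derivative f') (at x)"
    using assms unfolding differentiable_def by blast
  then have "linear f'"
    by (rule has_derivative_linear)
  then have "f' = (\<lambda>h. inner h (adjoint f' 1))"
    by (simp add: adjoint_works fun_eq_iff)
  with f' have "GDERIV f x :> adjoint f' 1"
    unfolding gderiv_def by simp
  with gradient_eqI show ?thesis
    by metis
qed

(* Multiplication on the type of vectors is componentwise in HOL-Analysis. *)
abbreviation hadamard :: "real ^ 'n \<Rightarrow> real ^ 'n \<Rightarrow> real ^ 'n"  (infixl "\<odot>" 70) where
  "u \<odot> v \<equiv> u * v"

lemma hadamard_component: "(u \<odot> v) $ i = u $ i * v $ i"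
  by simp

definition l1norm :: "real ^ 'n \<Rightarrow> real" where
  "l1norm x = (\<Sum>i\<in>UNIV. \<bar>x $ i\<bar>)"

definition Phi :: "(real ^ 'n \<Rightarrow> real) \<Rightarrow> real ^ 'n \<Rightarrow> real" where
  "Phi F x = F x + l1norm x"

definition G :: "(real ^ 'n \<Rightarrow> real) \<Rightarrow> (real ^ 'n) \<times> (real ^ 'n) \<Rightarrow> real" where
  "G F = (\<lambda>(u, v). (norm u)\<^sup>2 / 2 + (norm v)\<^sup>2 / 2 + F (u \<odot> v))"

end

theory Submission
  imports Defs
begin

text \<open>
  The iterates are gradient descent on the smooth function \<open>G F\<close>, and \<open>G F\<close> and \<open>Phi F\<close> differ
  along them by an exponentially small amount.  Indeed \<open>\<bar>s * t\<bar>\<close> is the smallest value of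
  \<open>(a\<^sup>2 + b\<^sup>2) / 2\<close> over the factorizations \<open>a * b = s * t\<close>, and the gap at \<open>(s, t)\<close> is
  \<open>(\<bar>s\<bar> - \<bar>t\<bar>)\<^sup>2 / 2\<close>, which is at most \<open>\<bar>s\<^sup>2 - t\<^sup>2\<bar> / 2\<close>
  (\<open>G_minus_Phi_le\<close>).  The imbalance \<open>s\<^sup>2 - t\<^sup>2\<close> would be conserved by the gradient flow
  of \<open>F (u \<odot> v)\<close> alone; the weight decay shrinks it.  In a step of size \<open>\<tau>\<close> each of its
  components is multiplied by exactly \<open>(1 - \<tau>)\<^sup>2 - (\<tau> * g)\<^sup>2\<close>, where \<open>g\<close> is the
  partial derivative of \<open>F\<close>.  The condition \<open>\<tau> * (1 + K\<^sup>2) \<le> 1\<close> keeps this factor within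
  \<open>\<rho> = 1 - \<tau>\<close> in absolute value (\<open>l1norm_imbalance_step\<close>).

  For \<open>G F\<close> itself, the two-sided second order estimate for functions with Lipschitz gradient shows
  that a step decreases the value by at least \<open>\<tau> / 2\<close> and at most \<open>3 / 2 * \<tau>\<close> times the squared
  gradient norm (\<open>gradient_descent_limit\<close>).  The lower estimate makes the squared norms summable,
  since \<open>G F\<close> is bounded below on the iterates.  The upper estimate, summed from step \<open>k\<close> on,
  bounds the distance of the \<open>k\<close>-th value to the limit \<open>L\<close> by the tail of that series.  As the gap
  vanishes, \<open>L\<close> is also the limit of \<open>Phi F\<close>, and \<open>Phi F \<le> G F\<close> carries the bound over.

  For the final rate, the tail of \<open>1 / j\<^sup>2\<close> is \<open>O(1 / k)\<close>.  The values of \<open>Phi F\<close> may lie below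
  \<open>L\<close>, but by no more than the gap, and \<open>\<rho> ^ k\<close> is \<open>O(1 / k)\<close> as well.
\<close>

section \<open>Gradient descent on a function with Lipschitz gradient\<close>

text \<open>
  Along the segment from \<open>y\<close> to \<open>z\<close>, the slope of \<open>f\<close> exceeds its initial value by at most
  \<open>M * t * (norm (z - y))\<^sup>2\<close>, so subtracting the integrated bound leaves a nonincreasing function of
  \<open>t\<close>.  Convexity of \<open>S\<close> keeps the segment where the Lipschitz bound is available.
\<close>

lemma lipschitz_gradient_upper_bound:
  fixes f :: "'a::real_inner \<Rightarrow> real"
  assumes "convex S" and "M-lipschitz_on S g"
    and deriv: "\<And>z. z \<in> S \<Longrightarrow> GDERIV f z :> g z"
    and y: "y \<in> S" and z: "z \<in> S"
  shows "f z \<le> f y + inner (z - y) (g y) + M / 2 * (norm (z - y))\<^sup>2"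
proof -
  define p where "p t = y + t *\<^sub>R (z - y)" for t :: real
  define \<phi> where "\<phi> t = f (p t) - t * inner (z - y) (g y) - M / 2 * t\<^sup>2 * (norm (z - y))\<^sup>2" for t
  have p_in: "p t \<in> S" if "0 \<le> t" "t \<le> 1" for t
  proof -
    have "p t = (1 - t) *\<^sub>R y + t *\<^sub>R z"
      by (simp add: p_def algebra_simps)
    then show ?thesis
      using convexD_alt[OF assms(1) y z that] by simp
  qed
  have f_p: "((\<lambda>t. f (p t)) has_real_derivative inner (z - y) (g (p t))) (at t)"
    if "0 \<le> t" "t \<le> 1" for t
  proof -
    have "(p has_derivative (\<lambda>h. h *\<^sub>R (z - y))) (at t)"
      unfolding p_def by (auto intro!: derivative_eq_intros)
    moreover have "(f has_derivative (\<lambda>h. inner h (g (p t)))) (at (p t))"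
      using deriv[OF p_in[OF that]] by (simp add: gderiv_def)
    ultimately have "((\<lambda>t. f (p t)) has_derivative (\<lambda>h. inner (h *\<^sub>R (z - y)) (g (p t)))) (at t)"
      by (rule has_derivative_compose)
    then show ?thesis
      by (simp add: has_field_derivative_def mult.commute[of _ "inner _ _"])
  qed
  have "\<phi> 1 \<le> \<phi> 0"
  proof (rule DERIV_nonpos_imp_nonincreasing[where f = \<phi>])
    fix t :: real assume t: "0 \<le> t" "t \<le> 1"
    have "(\<phi> has_real_derivative inner (z - y) (g (p t)) - inner (z - y) (g y)
        - M * t * (norm (z - y))\<^sup>2) (at t)"
      unfolding \<phi>_def by (auto intro!: derivative_eq_intros f_p t)
    moreover have "inner (z - y) (g (p t)) - inner (z - y) (g y) \<le> M * t * (norm (z - y))\<^sup>2"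
    proof -
      have "inner (z - y) (g (p t) - g y) \<le> norm (z - y) * norm (g (p t) - g y)"
        by (rule norm_cauchy_schwarz)
      also have "\<dots> \<le> norm (z - y) * (M * norm (p t - y))"
        using lipschitz_onD[OF assms(2) p_in[OF t] y]
        by (intro mult_left_mono) (auto simp: dist_norm)
      also have "\<dots> = M * t * (norm (z - y))\<^sup>2"
        using t by (simp add: p_def power2_eq_square)
      finally show ?thesis by (simp add: inner_diff_right)
    qed
    ultimately show "\<exists>D. (\<phi> has_real_derivative D) (at t) \<and> D \<le> 0"
      by fastforce
  qed simp
  then show ?thesis by (simp add: \<phi>_def p_def)
qed

lemma lipschitz_gradient_bound:
  fixes f :: "'a::real_inner \<Rightarrow> real"
  assumes "convex S" and "M-lipschitz_on S g"
    and deriv: "\<And>z. z \<in> S \<Longrightarrow> GDERIV f z :> g z"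
    and "y \<in> S" and "z \<in> S"
  shows "\<bar>f z - f y - inner (z - y) (g y)\<bar> \<le> M / 2 * (norm (z - y))\<^sup>2"
proof -
  have "GDERIV (\<lambda>z. - f z) z :> - g z" if "z \<in> S" for z
    using deriv[OF that] by (rule GDERIV_minus)
  moreover have "M-lipschitz_on S (\<lambda>z. - g z)"
    using assms(2) by (simp add: lipschitz_on_minus_iff)
  ultimately have "- f z \<le> - f y + inner (z - y) (- g y) + M / 2 * (norm (z - y))\<^sup>2"
    using assms by (intro lipschitz_gradient_upper_bound[of S M "\<lambda>z. - g z"]) auto
  moreover have "f z \<le> f y + inner (z - y) (g y) + M / 2 * (norm (z - y))\<^sup>2"
    using assms by (intro lipschitz_gradient_upper_bound)
  ultimately show ?thesis
    unfolding abs_le_iff inner_minus_right by linarith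
qed

text \<open>
  For a step along the negative gradient the linear term of the second order estimate is
  \<open>- \<tau> * (norm (g (z k)))\<^sup>2\<close>, and \<open>\<tau> * M \<le> 1\<close> makes the remainder at most half of that in
  absolute value.  So the decrease in each step is comparable from both sides with the squared
  gradient norm.  The decreases telescope to the distance from the limit.
\<close>

lemma gradient_descent_limit:
  fixes f :: "'a::real_inner \<Rightarrow> real" and z :: "nat \<Rightarrow> 'a"
  assumes S: "convex S" and lip: "M-lipschitz_on S g"
    and deriv: "\<And>z. z \<in> S \<Longrightarrow> GDERIV f z :> g z"
    and step: "\<And>k. z (Suc k) = z k - \<tau> *\<^sub>R g (z k)"
    and z_in: "\<And>k. z k \<in> S"
    and lower: "\<And>k. m \<le> f (z k)"
    and \<tau>: "0 < \<tau>" "\<tau> * M \<le> 1"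
  obtains L where "(\<lambda>k. f (z k)) \<longlonglongrightarrow> L"
    and "summable (\<lambda>k. (norm (g (z k)))\<^sup>2)"
    and "\<And>k. L \<le> f (z k)"
    and "\<And>k. f (z k) - L \<le> 3 / 2 * \<tau> * (\<Sum>j. (norm (g (z (k + j))))\<^sup>2)"
proof -
  define s where "s k = (norm (g (z k)))\<^sup>2" for k
  have step_bound: "\<bar>f (z (Suc k)) - f (z k) + \<tau> * s k\<bar> \<le> \<tau> / 2 * s k" for k
  proof -
    have "\<bar>f (z (Suc k)) - f (z k) - inner (z (Suc k) - z k) (g (z k))\<bar>
        \<le> M / 2 * (norm (z (Suc k) - z k))\<^sup>2"
      using S lip deriv z_in by (intro lipschitz_gradient_bound)
    also have "inner (z (Suc k) - z k) (g (z k)) = - (\<tau> * s k)"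
      by (simp add: step s_def power2_norm_eq_inner)
    also have "M / 2 * (norm (z (Suc k) - z k))\<^sup>2 = (\<tau> * M) * (\<tau> / 2 * s k)"
      using \<tau> by (simp add: step s_def power_mult_distrib power2_eq_square)
    also have "\<dots> \<le> 1 * (\<tau> / 2 * s k)"
      using \<tau> by (intro mult_right_mono) (auto simp: s_def)
    finally show ?thesis by simp
  qed
  have s_nonneg: "0 \<le> s k" for k
    by (simp add: s_def)
  have decrease: "\<tau> / 2 * s k \<le> f (z k) - f (z (Suc k))" for k
    using abs_le_D1[OF step_bound[of k]] abs_le_D2[OF step_bound[of k]] by (simp add: field_simps)
  have increase: "f (z k) - f (z (Suc k)) \<le> 3 / 2 * \<tau> * s k" for k
    using abs_le_D1[OF step_bound[of k]] abs_le_D2[OF step_bound[of k]] by (simp add: field_simps)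
  have "f (z (Suc k)) \<le> f (z k)" for k
    using order_trans[OF _ decrease[of k], of 0] s_nonneg[of k] \<tau> by simp
  then have dec: "decseq (\<lambda>k. f (z k))"
    by (simp add: decseq_Suc_iff)
  then obtain L where L: "(\<lambda>k. f (z k)) \<longlonglongrightarrow> L" and L_le: "\<And>k. L \<le> f (z k)"
    using decseq_convergent lower by metis
  have tele: "(\<lambda>j. f (z (k + j)) - f (z (Suc (k + j)))) sums (f (z k) - L)" for k
  proof -
    have "(\<lambda>j. f (z (k + j))) \<longlonglongrightarrow> L"
      using LIMSEQ_ignore_initial_segment[OF L, of k] by (simp add: add.commute)
    from telescope_sums'[OF this] show ?thesis by simp
  qed
  have "summable (\<lambda>k. \<tau> / 2 * s k)"
  proof (rule summable_comparison_test')
    show "summable (\<lambda>k. f (z k) - f (z (Suc k)))"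
      using tele[of 0] by (simp add: sums_iff)
    show "norm (\<tau> / 2 * s k) \<le> f (z k) - f (z (Suc k))" for k
      using decrease[of k] \<tau> s_nonneg[of k] by simp
  qed
  then have s_summable: "summable s"
    using \<tau> summable_cmult_iff[of "\<tau> / 2" s] by simp
  have "f (z k) - L \<le> 3 / 2 * \<tau> * (\<Sum>j. s (k + j))" for k
  proof -
    have sk: "summable (\<lambda>j. s (k + j))"
      using summable_ignore_initial_segment[OF s_summable, of k] by (simp add: add.commute)
    have "f (z k) - L \<le> (\<Sum>j. 3 / 2 * \<tau> * s (k + j))"
      using tele[of k] increase sk
      by (intro sums_le[OF _ tele[of k] summable_sums]) (auto intro: summable_mult)
    also have "\<dots> = 3 / 2 * \<tau> * (\<Sum>j. s (k + j))"
      using sk by (rule suminf_mult)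
    finally show ?thesis .
  qed
  with that L L_le s_summable show ?thesis
    unfolding s_def by blast
qed

section \<open>Tails of series dominated by inverse squares\<close>

text \<open>
  The tail is compared with a telescoping series through
  \<open>1 / r\<^sup>2 \<le> 2 / (r * (r + 1)) = 2 / r - 2 / (r + 1)\<close> for \<open>r \<ge> 1\<close>.
\<close>

lemma suminf_tail_inverse_squares_le:
  fixes s :: "nat \<Rightarrow> real"
  assumes "summable s" and "0 \<le> c" and "0 < k"
    and le: "\<And>j. k \<le> j \<Longrightarrow> s j \<le> c / (real j)\<^sup>2"
  shows "(\<Sum>j. s (k + j)) \<le> 2 * c / real k"
proof -
  have tele: "(\<lambda>j. 2 * c / real (k + j) - 2 * c / real (k + Suc j)) sums (2 * c / real (k + 0) - 0)"
  proof (rule telescope_sums')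
    have "(\<lambda>j. 2 * c / real j) \<longlonglongrightarrow> 0"
      by (rule lim_const_over_n)
    then show "(\<lambda>j. 2 * c / real (k + j)) \<longlonglongrightarrow> 0"
      using LIMSEQ_ignore_initial_segment[of "\<lambda>j. 2 * c / real j" 0 k] by (simp add: add.commute)
  qed
  have "s (k + j) \<le> 2 * c / real (k + j) - 2 * c / real (k + Suc j)" for j
  proof -
    define r where "r = real (k + j)"
    have "r \<ge> 1" using assms(3) by (simp add: r_def)
    have "s (k + j) \<le> c / r\<^sup>2"
      using le[of "k + j"] by (simp add: r_def)
    also have "\<dots> = 2 * c / (2 * r\<^sup>2)"
      by simp
    also have "\<dots> \<le> 2 * c / (r * (r + 1))"
      using \<open>r \<ge> 1\<close> assms(2) by (intro divide_left_mono) (auto simp: power2_eq_square)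
    also have "\<dots> = 2 * c / r - 2 * c / (r + 1)"
      using \<open>r \<ge> 1\<close> by (simp add: field_simps)
    finally show ?thesis by (simp add: r_def add_ac)
  qed
  moreover have "summable (\<lambda>j. s (k + j))"
    using summable_ignore_initial_segment[OF assms(1), of k] by (simp add: add.commute)
  ultimately show ?thesis
    using sums_le[OF _ summable_sums tele] by simp
qed

section \<open>The factorized objective\<close>

lemma bounded_bilinear_hadamard: "bounded_bilinear (\<lambda>a b :: real ^ 'n. a \<odot> b)"
  unfolding bilinear_conv_bounded_bilinear[symmetric] bilinear_def
  by (auto intro!: linearI simp: vec_eq_iff algebra_simps)

lemma GDERIV_G:
  fixes F :: "real ^ 'n \<Rightarrow> real"
  assumes "F differentiable (at (a \<odot> b))"
  shows "GDERIV (G F) (a, b) :>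
    (a + b \<odot> gradient F (a \<odot> b), b + a \<odot> gradient F (a \<odot> b))"
proof -
  define g where "g = gradient F (a \<odot> b)"
  have F: "(F has_derivative (\<lambda>h. inner h g)) (at (fst (a, b) \<odot> snd (a, b)))"
    using gradient_works[OF assms] by (simp add: gderiv_def g_def)
  have prod: "((\<lambda>p. fst p \<odot> snd p) has_derivative (\<lambda>h. fst (a, b) \<odot> snd h + fst h \<odot> snd (a, b)))
      (at (a, b))"
    by (rule bounded_bilinear.FDERIV[OF bounded_bilinear_hadamard])
       (auto intro!: derivative_intros)
  have F_prod: "((\<lambda>p. F (fst p \<odot> snd p)) has_derivative (\<lambda>h. inner (a \<odot> snd h + fst h \<odot> b) g))
      (at (a, b))"
    using has_derivative_compose[OF prod F] by simp
  have G_eq: "G F = (\<lambda>p. inner (fst p) (fst p) / 2 + inner (snd p) (snd p) / 2 + F (fst p \<odot> snd p))"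
    by (simp add: G_def fun_eq_iff power2_norm_eq_inner)
  have move: "inner (c \<odot> h) g = inner h (c \<odot> g)" "inner (h \<odot> c) g = inner h (c \<odot> g)"
    for c h :: "real ^ 'n"
    by (auto simp: inner_vec_def mult_ac intro!: sum.cong)
  have "(G F has_derivative (\<lambda>h. inner (fst h) a + inner (snd h) b
      + inner (a \<odot> snd h + fst h \<odot> b) g)) (at (a, b))"
    unfolding G_eq
    by (rule derivative_eq_intros F_prod refl | simp)+
       (simp add: fun_eq_iff inner_commute)
  then show ?thesis
    unfolding gderiv_def g_def[symmetric]
    by (rule has_derivative_eq_rhs) (simp add: fun_eq_iff inner_add_left inner_add_right inner_prod_def move(1)[of a] move(2)[of _ b])
qed

text \<open>
  This puts the products of the iterates into the \<open>l1\<close> ball on which the gradient of \<open>F\<close> is bounded.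
\<close>

lemma l1norm_hadamard_le: "l1norm (a \<odot> b) \<le> ((norm a)\<^sup>2 + (norm b)\<^sup>2) / 2"
proof -
  have "\<bar>s * t\<bar> \<le> (s * s + t * t) / 2" for s t :: real
    using sum_squares_bound[of "\<bar>s\<bar>" "\<bar>t\<bar>"] by (simp add: abs_mult power2_eq_square)
  then have "l1norm (a \<odot> b) \<le> (\<Sum>i\<in>UNIV. (a $ i * a $ i + b $ i * b $ i) / 2)"
    unfolding l1norm_def by (intro sum_mono) simp
  then show ?thesis
    by (simp add: power2_norm_eq_inner inner_vec_def sum.distrib sum_divide_distrib add_divide_distrib)
qed

lemma G_minus_Phi: "G F (a, b) - Phi F (a \<odot> b) = (\<Sum>i\<in>UNIV. (\<bar>a $ i\<bar> - \<bar>b $ i\<bar>)\<^sup>2 / 2)"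
proof -
  have "(\<bar>s\<bar> - \<bar>t\<bar>)\<^sup>2 / 2 = (s * s + t * t) / 2 - \<bar>s * t\<bar>" for s t :: real
    by (simp add: power2_diff abs_mult field_simps) (simp add: power2_eq_square)
  then show ?thesis
    unfolding G_def Phi_def l1norm_def power2_norm_eq_inner inner_vec_def
    by (simp add: sum.distrib sum_subtractf sum_divide_distrib[symmetric] sum_distrib_right[symmetric]
        add_divide_distrib)
qed

lemma Phi_le_G: "Phi F (a \<odot> b) \<le> G F (a, b)"
proof -
  have "0 \<le> G F (a, b) - Phi F (a \<odot> b)"
    unfolding G_minus_Phi by (intro sum_nonneg) simp
  then show ?thesis by simp
qed

text \<open>
  Since \<open>\<bar>\<bar>s\<bar> - \<bar>t\<bar>\<bar> \<le> \<bar>s\<bar> + \<bar>t\<bar>\<close>, one of the two factors of the squared difference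
  can be replaced by the sum, which produces \<open>\<bar>s\<^sup>2 - t\<^sup>2\<bar>\<close>.
\<close>

lemma G_minus_Phi_le: "G F (a, b) - Phi F (a \<odot> b) \<le> l1norm (a \<odot> a - b \<odot> b) / 2"
proof -
  have "(\<bar>s\<bar> - \<bar>t\<bar>)\<^sup>2 \<le> \<bar>s * s - t * t\<bar>" for s t :: real
  proof -
    have "(\<bar>s\<bar> - \<bar>t\<bar>)\<^sup>2 = \<bar>\<bar>s\<bar> - \<bar>t\<bar>\<bar> * \<bar>\<bar>s\<bar> - \<bar>t\<bar>\<bar>"
      by (simp add: power2_eq_square)
    also have "\<dots> \<le> \<bar>\<bar>s\<bar> - \<bar>t\<bar>\<bar> * \<bar>\<bar>s\<bar> + \<bar>t\<bar>\<bar>"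
      by (intro mult_left_mono) auto
    also have "\<dots> = \<bar>s * s - t * t\<bar>"
      unfolding abs_mult[symmetric] by (simp add: algebra_simps)
    finally show ?thesis .
  qed
  then show ?thesis
    unfolding G_minus_Phi l1norm_def sum_divide_distrib by (intro sum_mono divide_right_mono) auto
qed

section \<open>Contraction of the imbalance\<close>

text \<open>
  Both squares lie between \<open>0\<close> and \<open>1 - \<tau>\<close>, hence so does the absolute value of their difference.
  For the second square, \<open>\<tau> * (1 + K\<^sup>2) \<le> 1\<close> says that \<open>\<tau> * K\<^sup>2 \<le> 1 - \<tau>\<close>.  The separate
  factors \<open>1 - \<tau> * (1 + g)\<close> and \<open>1 - \<tau> * (1 - g)\<close> of the expression may exceed \<open>1\<close>; only
  their product is controlled.
\<close>

lemma imbalance_factor_le: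
  fixes \<tau> g K :: real
  assumes "0 < \<tau>" and "\<tau> * (1 + K\<^sup>2) \<le> 1" and "\<bar>g\<bar> \<le> K"
  shows "\<bar>(1 - \<tau>)\<^sup>2 - (\<tau> * g)\<^sup>2\<bar> \<le> 1 - \<tau>"
proof -
  have "\<tau> \<le> \<tau> * (1 + K\<^sup>2)"
    using assms(1) by simp
  then have \<tau>: "\<tau> \<le> 1"
    using assms(2) by simp
  have upper: "(1 - \<tau>)\<^sup>2 \<le> 1 - \<tau>"
    using assms(1) \<tau> mult_left_mono[of "1 - \<tau>" 1 "1 - \<tau>"] by (simp add: power2_eq_square)
  have "g\<^sup>2 \<le> K\<^sup>2"
    using assms(3) by (simp add: abs_le_square_iff[symmetric])
  then have "\<tau> * g\<^sup>2 \<le> \<tau> * K\<^sup>2"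
    using assms(1) by simp
  then have "\<tau> * g\<^sup>2 \<le> 1 - \<tau>"
    using assms(2) by (simp add: algebra_simps)
  then have "\<tau> * (\<tau> * g\<^sup>2) \<le> 1 * (1 - \<tau>)"
    using assms(1) \<tau> by (intro mult_mono) auto
  then have lower: "(\<tau> * g)\<^sup>2 \<le> 1 - \<tau>"
    by (simp add: power2_eq_square mult_ac)
  show ?thesis
    using upper lower zero_le_power2[of "\<tau> * g"] zero_le_power2[of "1 - \<tau>"] unfolding abs_le_iff by linarith
qed

text \<open>
  The step mixes the two factors by a symmetric matrix with diagonal \<open>1 - \<tau>\<close> and off-diagonal
  \<open>- \<tau> * g $ i\<close>, so the difference of squares in each component is multiplied by the determinant.
\<close>

lemma l1norm_imbalance_step:
  fixes a b g :: "real ^ 'n"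
  assumes "0 < \<tau>" and "\<tau> * (1 + K\<^sup>2) \<le> 1" and "infnorm g \<le> K"
    and a': "a' = a - \<tau> *\<^sub>R (a + b \<odot> g)" and b': "b' = b - \<tau> *\<^sub>R (b + a \<odot> g)"
  shows "l1norm (a' \<odot> a' - b' \<odot> b') \<le> (1 - \<tau>) * l1norm (a \<odot> a - b \<odot> b)"
proof -
  have "\<bar>a' $ i * a' $ i - b' $ i * b' $ i\<bar> \<le> (1 - \<tau>) * \<bar>a $ i * a $ i - b $ i * b $ i\<bar>" for i
  proof -
    have "\<bar>g $ i\<bar> \<le> K"
      using component_le_infnorm_cart[of g i] assms(3) by simp
    then have "\<bar>(1 - \<tau>)\<^sup>2 - (\<tau> * g $ i)\<^sup>2\<bar> \<le> 1 - \<tau>"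
      using assms(1,2) by (intro imbalance_factor_le)
    moreover have "a' $ i * a' $ i - b' $ i * b' $ i
        = ((1 - \<tau>)\<^sup>2 - (\<tau> * g $ i)\<^sup>2) * (a $ i * a $ i - b $ i * b $ i)"
      by (simp add: a' b' power2_eq_square algebra_simps)
    ultimately show ?thesis
      by (simp add: abs_mult mult_right_mono)
  qed
  then show ?thesis
    unfolding l1norm_def sum_distrib_left by (intro sum_mono) simp
qed

section \<open>Convergence of the objective\<close>

theorem proposition7:
  fixes F :: "real ^ 'n \<Rightarrow> real"
    and u v x :: "nat \<Rightarrow> real ^ 'n"
    and B K M_F M_G \<kappa> \<tau> \<rho> :: real
  assumes F_diff: "F differentiable_on UNIV"
    and F_convex: "convex_on UNIV F"
    and B_def: "B\<^sup>2 / 2 = G F (u 0, v 0)"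
    and u_step: "\<And>k. u (Suc k) = u k - \<tau> *\<^sub>R (u k + v k \<odot> gradient F (u k \<odot> v k))"
    and v_step: "\<And>k. v (Suc k) = v k - \<tau> *\<^sub>R (v k + u k \<odot> gradient F (u k \<odot> v k))"
    and x_def: "\<And>k. x k = u k \<odot> v k"
    and iterates_bounded: "\<And>k. ((norm (u k))\<^sup>2 + (norm (v k))\<^sup>2) / 2 \<le> B\<^sup>2 / 2"
    and gradF_lipschitz: "\<And>y z. infnorm (gradient F y - gradient F z) \<le> M_F * l1norm (y - z)"
    and gradF_bounded: "\<And>y. l1norm y \<le> B\<^sup>2 / 2 \<Longrightarrow> infnorm (gradient F y) \<le> K"
    and M_G_pos: "M_G > 0"
    and gradG_lipschitz:
      "M_G-lipschitz_on {(a, b). ((norm a)\<^sup>2 + (norm b)\<^sup>2) / 2 \<le> B\<^sup>2 / 2} (gradient (G F))"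
    and \<kappa>_def: "\<kappa> = max 1 ((1 + K\<^sup>2) / M_G)"
    and \<tau>_def: "\<tau> = 1 / (\<kappa> * M_G)"
    and \<rho>_def: "\<rho> = 1 - 1 / (\<kappa> * M_G)"
  shows "convergent (\<lambda>j. Phi F (x j)) \<and>
         summable (\<lambda>j. (norm (gradient (G F) (u j, v j)))\<^sup>2) \<and>
         (\<exists>C. \<forall>k. Phi F (x k) - lim (\<lambda>j. Phi F (x j))
           \<le> C * (\<Sum>j. (norm (gradient (G F) (u (k + j), v (k + j))))\<^sup>2) + C * \<rho> ^ k) \<and>
         ((\<lambda>k. norm (gradient (G F) (u k, v k))) \<in> O(\<lambda>k. 1 / real k) \<longrightarrow>
          (\<lambda>k. Phi F (x k) - lim (\<lambda>j. Phi F (x j))) \<in> O(\<lambda>k. 1 / real k))"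
proof -
  define S where "S = {(a :: real ^ 'n, b :: real ^ 'n). ((norm a)\<^sup>2 + (norm b)\<^sup>2) / 2 \<le> B\<^sup>2 / 2}"
  define W where "W k = l1norm (u k \<odot> u k - v k \<odot> v k)" for k
  have \<kappa>: "1 \<le> \<kappa>" "1 + K\<^sup>2 \<le> \<kappa> * M_G"
    using M_G_pos by (auto simp: \<kappa>_def field_simps max_def)
  have \<tau>_pos: "0 < \<tau>" and \<tau>_M: "\<tau> * M_G \<le> 1" and \<tau>_K: "\<tau> * (1 + K\<^sup>2) \<le> 1"
    using \<kappa> M_G_pos by (auto simp: \<tau>_def divide_simps)
  have \<rho>: "\<rho> = 1 - \<tau>"
    by (simp add: \<rho>_def \<tau>_def)
  have \<rho>_bounds: "0 \<le> \<rho>" "\<rho> < 1"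
    using \<tau>_pos order_trans[OF _ \<tau>_K, of \<tau>] by (simp_all add: \<rho>)
  have F_diff_at: "F differentiable (at y)" for y
    using F_diff by (simp add: differentiable_on_def)
  have grad_G: "gradient (G F) (a, b) =
      (a + b \<odot> gradient F (a \<odot> b), b + a \<odot> gradient F (a \<odot> b))" for a b
    by (intro gradient_eqI GDERIV_G F_diff_at)
  have GDERIV_G': "GDERIV (G F) z :> gradient (G F) z" for z
    using GDERIV_G[OF F_diff_at] grad_G by (cases z) simp
  \<comment> \<open>On pairs the product norm is Euclidean, so the sublevel set of the hypothesis is a ball and
      in particular convex.\<close>
  have S_ball: "S = cball 0 \<bar>B\<bar>"
    by (auto simp: S_def norm_prod_def real_sqrt_abs[symmetric] simp del: real_sqrt_abs)
  have x_l1: "l1norm (x k) \<le> B\<^sup>2 / 2" for k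
    using l1norm_hadamard_le[of "u k" "v k"] iterates_bounded[of k] by (simp add: x_def)
  have grad_K: "infnorm (gradient F (x k)) \<le> K" for k
    by (rule gradF_bounded[OF x_l1])

  \<comment> \<open>The lower bound on the objective comes from compactness of a ball that contains every
      \<open>x k\<close>.\<close>
  have x_ball: "x k \<in> cball 0 (B\<^sup>2 / 2)" for k
    using norm_le_l1_cart[of "x k"] x_l1[of k] by (simp add: l1norm_def)
  have "continuous_on (cball 0 (B\<^sup>2 / 2)) F"
    using F_diff differentiable_imp_continuous_on continuous_on_subset by blast
  then have "bounded (F ` cball 0 (B\<^sup>2 / 2))"
    by (intro compact_imp_bounded compact_continuous_image compact_cball)
  then obtain m where m: "\<And>y. y \<in> cball 0 (B\<^sup>2 / 2) \<Longrightarrow> \<bar>F y\<bar> \<le> m"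
    unfolding bounded_iff real_norm_def by blast
  have G_lower: "- m \<le> G F (u k, v k)" for k
  proof -
    have "F (x k) \<le> G F (u k, v k)"
      by (simp add: G_def x_def)
    then show ?thesis
      using m[OF x_ball[of k]] by (simp add: abs_le_iff)
  qed

  obtain L where L: "(\<lambda>k. G F (u k, v k)) \<longlonglongrightarrow> L"
    and grad_summable: "summable (\<lambda>k. (norm (gradient (G F) (u k, v k)))\<^sup>2)"
    and L_le: "\<And>k. L \<le> G F (u k, v k)"
    and G_tail: "\<And>k. G F (u k, v k) - L
      \<le> 3 / 2 * \<tau> * (\<Sum>j. (norm (gradient (G F) (u (k + j), v (k + j))))\<^sup>2)"
  proof (rule gradient_descent_limit[of S M_G "gradient (G F)" "G F" "\<lambda>k. (u k, v k)" \<tau> "- m"])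
    show "convex S"
      by (simp add: S_ball)
    show "M_G-lipschitz_on S (gradient (G F))"
      using gradG_lipschitz by (simp add: S_def)
    show "(u (Suc k), v (Suc k)) = (u k, v k) - \<tau> *\<^sub>R gradient (G F) (u k, v k)" for k
      by (simp add: grad_G u_step v_step)
    show "(u k, v k) \<in> S" for k
      using iterates_bounded[of k] by (simp add: S_def)
  qed (use GDERIV_G' G_lower \<tau>_pos \<tau>_M in auto)

  have W_decay: "W k \<le> W 0 * \<rho> ^ k" for k
  proof (induction k)
    case (Suc k)
    have "W (Suc k) \<le> \<rho> * W k"
      unfolding W_def \<rho> using \<tau>_pos \<tau>_K grad_K[of k] u_step[of k] v_step[of k]
      by (intro l1norm_imbalance_step) (simp_all add: x_def)
    also have "\<dots> \<le> \<rho> * (W 0 * \<rho> ^ k)"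
      using Suc \<rho>_bounds by (intro mult_left_mono)
    finally show ?case by (simp add: mult_ac)
  qed simp
  have W0: "0 \<le> W 0"
    by (simp add: W_def l1norm_def sum_nonneg)
  have Phi_G: "Phi F (x k) \<le> G F (u k, v k)" "G F (u k, v k) - W 0 * \<rho> ^ k \<le> Phi F (x k)" for k
  proof -
    show "Phi F (x k) \<le> G F (u k, v k)"
      by (simp add: x_def Phi_le_G)
    have "G F (u k, v k) - Phi F (x k) \<le> W k / 2"
      unfolding x_def W_def by (rule G_minus_Phi_le)
    moreover have "W k / 2 \<le> W 0 * \<rho> ^ k"
    proof -
      have "0 \<le> W k" by (simp add: W_def l1norm_def sum_nonneg)
      then show ?thesis using W_decay[of k] by linarith
    qed
    ultimately show "G F (u k, v k) - W 0 * \<rho> ^ k \<le> Phi F (x k)"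
      by linarith
  qed
  have Phi_lim: "(\<lambda>k. Phi F (x k)) \<longlonglongrightarrow> L"
  proof (rule tendsto_sandwich)
    have "(\<lambda>k. \<rho> ^ k) \<longlonglongrightarrow> 0"
      using \<rho>_bounds by (intro LIMSEQ_power_zero) simp
    from tendsto_diff[OF L tendsto_mult_left[OF this, of "W 0"]]
    show "(\<lambda>k. G F (u k, v k) - W 0 * \<rho> ^ k) \<longlonglongrightarrow> L"
      by simp
  qed (use Phi_G L in auto)
  then have lim_eq: "lim (\<lambda>k. Phi F (x k)) = L"
    by (rule limI)

  define T where "T k = (\<Sum>j. (norm (gradient (G F) (u (k + j), v (k + j))))\<^sup>2)" for k
  have T_nonneg: "0 \<le> T k" for k
    unfolding T_def
    using summable_ignore_initial_segment[OF grad_summable, of k]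
    by (intro suminf_nonneg) (simp_all add: add.commute)
  have Phi_upper: "Phi F (x k) - L \<le> 3 / 2 * \<tau> * T k" for k
    using Phi_G(1)[of k] G_tail[of k] by (simp add: T_def)
  have Phi_lower: "- (W 0 * \<rho> ^ k) \<le> Phi F (x k) - L" for k
    using Phi_G(2)[of k] L_le[of k] by linarith

  have "\<exists>C. \<forall>k. Phi F (x k) - L \<le> C * T k + C * \<rho> ^ k"
  proof (intro exI allI)
    fix k
    have "0 \<le> 3 / 2 * \<tau> * \<rho> ^ k"
      using \<tau>_pos \<rho>_bounds by simp
    then show "Phi F (x k) - L \<le> 3 / 2 * \<tau> * T k + 3 / 2 * \<tau> * \<rho> ^ k"
      using Phi_upper[of k] by linarith
  qed
  moreover have "(\<lambda>k. Phi F (x k) - L) \<in> O(\<lambda>k. 1 / real k)"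
    if grad_O: "(\<lambda>k. norm (gradient (G F) (u k, v k))) \<in> O(\<lambda>k. 1 / real k)"
  proof -
    obtain c where c: "0 < c"
      "\<forall>\<^sub>F k in sequentially. norm (norm (gradient (G F) (u k, v k))) \<le> c * norm (1 / real k)"
      using grad_O by (rule landau_o.bigE)
    then obtain N where N: "\<And>k. N \<le> k \<Longrightarrow> norm (gradient (G F) (u k, v k)) \<le> c / real k"
      unfolding eventually_sequentially by auto
    \<comment> \<open>Index \<open>0\<close> is excluded because \<open>1 / real 0 = 0\<close>.\<close>
    have T_O: "T k \<le> 2 * c\<^sup>2 / real k" if "max N 1 \<le> k" for k
      unfolding T_def
    proof (rule suminf_tail_inverse_squares_le[OF grad_summable])
      fix j assume "k \<le> j"
      then show "(norm (gradient (G F) (u j, v j)))\<^sup>2 \<le> c\<^sup>2 / (real j)\<^sup>2"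
        using that power_mono[OF N[of j] norm_ge_zero, of 2] by (simp add: power_divide)
    qed (use that in auto)
    have "(\<lambda>k. real k * \<rho> ^ k) \<longlonglongrightarrow> 0"
      using \<rho>_bounds powser_times_n_limit_0[of \<rho>] by simp
    then have "Bseq (\<lambda>k. real k * \<rho> ^ k)"
      by (intro convergent_imp_Bseq convergentI)
    then obtain D where D: "0 < D" "\<And>k. norm (real k * \<rho> ^ k) \<le> D"
      by (auto elim: BseqE)
    have \<rho>_O: "\<rho> ^ k \<le> D / real k" if "1 \<le> k" for k
      using D(2)[of k] that \<rho>_bounds by (simp add: field_simps)
    show ?thesis
    proof (rule landau_o.bigI)
      define E where "E = 3 * \<tau> * c\<^sup>2 + W 0 * D + 1"
      have pos: "0 \<le> 3 * \<tau> * c\<^sup>2" "0 \<le> W 0 * D"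
        using \<tau>_pos W0 D(1) by simp_all
      then show "0 < E"
        by (simp add: E_def)
      show "\<forall>\<^sub>F k in sequentially. norm (Phi F (x k) - L) \<le> E * norm (1 / real k)"
        unfolding eventually_sequentially
      proof (intro exI allI impI)
        fix k assume k: "max N 1 \<le> k"
        have "3 / 2 * \<tau> * T k \<le> 3 / 2 * \<tau> * (2 * c\<^sup>2 / real k)"
          using T_O[OF k] \<tau>_pos by (intro mult_left_mono) auto
        also have "\<dots> = 3 * \<tau> * c\<^sup>2 / real k"
          by simp
        also have "\<dots> \<le> E / real k"
          using pos by (intro divide_right_mono) (auto simp: E_def)
        finally have up: "Phi F (x k) - L \<le> E / real k"
          using Phi_upper[of k] by linarith
        have "W 0 * \<rho> ^ k \<le> W 0 * (D / real k)"
          using \<rho>_O[of k] k W0 by (intro mult_left_mono) auto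
        also have "\<dots> = W 0 * D / real k"
          by simp
        also have "\<dots> \<le> E / real k"
          using pos by (intro divide_right_mono) (auto simp: E_def)
        finally have "- (E / real k) \<le> Phi F (x k) - L"
          using Phi_lower[of k] by linarith
        with up show "norm (Phi F (x k) - L) \<le> E * norm (1 / real k)"
          by (simp add: abs_le_iff)
      qed
    qed
  qed
  ultimately show ?thesis
    using Phi_lim grad_summable unfolding lim_eq T_def by (blast intro: convergentI)
qed

end
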